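(* Let $f$ be a formula such that at least one of the following holds: (i) $ABCA.ABA.ACA\preceq f\preceq ABCA.ABA.ACA.ACB.CBA$; (ii) $ABCA.ABA.BCB.AC\preceq f\preceq ABCA.ABA.ABCBA.ACB$; (iii) $ABCA.ABA.BCB.CBA\preceq f\preceq ABCA.ABA.ABCBA.ACB$. Then every ternary recurrent infinite word avoiding $f$ is equivalent to $b_3$, $\sigma(b_3)$, or $\sigma^2(b_3)$.
   Context: A formula is a finite set of non-empty words over variables $A,B,C,\dots$ (fragments), written separated by dots. An occurrence of a formula $f$ in a word $w$ is a non-erasing morphism $h$ from variables to non-empty words such that $h(\phi)$ is a factor of $w$ for every fragment $\phi$ of $f$; $w$ avoids $f$ if it has no occurrence. $g\preceq f$ means there is a non-erasing morphism $h$ such that the $h$-image of every fragment of $g$ is a factor of some fragment of $f$. An infinite word is recurrent if each of its finite factors occurs infinitely often; two infinite words are equivalent if they have the same set of finite factors. On $\Sigma_3=\{0,1,2\}$, $\sigma$ is the morphism $0\mapsto1,1\mapsto2,2\mapsto0$, and $b_3$ is the fixed point starting with $0$ of the morphism $0\mapsto 012,\ 1\mapsto 02,\ 2\mapsto 1$. *)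

theory Defs
  imports Main "HOL-Library.Sublist" "HOL-Library.Omega_Words_Fun"
begin

definition morph :: "('a \<Rightarrow> 'b list) \<Rightarrow> 'a list \<Rightarrow> 'b list" where
  "morph h u = concat (map h u)"

definition nonerasing :: "('a \<Rightarrow> 'b list) \<Rightarrow> bool" where
  "nonerasing h \<longleftrightarrow> (\<forall>x. h x \<noteq> [])"

text \<open>The image of an infinite word under a morphism. Only meaningful for non-erasing \<open>h\<close>, where
  the image of the prefix of length \<open>n + 1\<close> has length greater than \<open>n\<close>.\<close>

definition morph_word :: "('a \<Rightarrow> 'b list) \<Rightarrow> 'a word \<Rightarrow> 'b word" where
  "morph_word h w = (\<lambda>n. morph h (w [0 \<rightarrow> Suc n]) ! n)"

definition factors :: "'a word \<Rightarrow> 'a list set" where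
  "factors w = {w [i \<rightarrow> j] | i j. i \<le> j}"

definition recurrent :: "'a word \<Rightarrow> bool" where
  "recurrent w \<longleftrightarrow> (\<forall>u \<in> factors w. infinite {i. w [i \<rightarrow> i + length u] = u})"

definition equivalent :: "'a word \<Rightarrow> 'a word \<Rightarrow> bool" where
  "equivalent v w \<longleftrightarrow> factors v = factors w"

text \<open>A formula over an arbitrary type of variables is the set of its fragments. Concrete formulas
  use characters as variables, so that fragments are string literals.\<close>

definition is_formula :: "'v list set \<Rightarrow> bool" where
  "is_formula f \<longleftrightarrow> finite f \<and> [] \<notin> f"

definition occurrence :: "('v \<Rightarrow> 'a list) \<Rightarrow> 'v list set \<Rightarrow> 'a word \<Rightarrow> bool" where
  "occurrence h f w \<longleftrightarrow> nonerasing h \<and> (\<forall>\<phi> \<in> f. morph h \<phi> \<in> factors w)"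

definition avoids :: "'a word \<Rightarrow> 'v list set \<Rightarrow> bool" where
  "avoids w f \<longleftrightarrow> \<not> (\<exists>h. occurrence h f w)"

definition divides :: "'u list set \<Rightarrow> 'v list set \<Rightarrow> bool" (infix "\<preceq>" 50) where
  "g \<preceq> f \<longleftrightarrow> (\<exists>h. nonerasing h \<and> (\<forall>\<phi> \<in> g. \<exists>\<psi> \<in> f. sublist (morph h \<phi>) \<psi>))"

datatype letter = L0 | L1 | L2

fun sigma :: "letter \<Rightarrow> letter" where
  "sigma L0 = L1"
| "sigma L1 = L2"
| "sigma L2 = L0"

fun beta :: "letter \<Rightarrow> letter list" where
  "beta L0 = [L0, L1, L2]"
| "beta L1 = [L0, L2]"
| "beta L2 = [L1]"

definition b3 :: "letter word" where
  "b3 = (THE w. w 0 = L0 \<and> morph_word beta w = w)"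

text \<open>The definite description above is well-defined.\<close>

lemma morph_append: "morph h (u @ v) = morph h u @ morph h v"
  by (simp add: morph_def)

lemma length_morph_beta: "length u \<le> length (morph beta u)"
proof (induction u)
  case (Cons a u)
  then show ?case by (cases a) (auto simp: morph_def)
qed (simp add: morph_def)

lemma length_morph_beta_prefix:
  assumes "w 0 = L0" and "n > 0"
  shows "n < length (morph beta (w [0 \<rightarrow> n]))"
proof -
  have "w [0 \<rightarrow> n] = [L0] @ w [1 \<rightarrow> n]"
    using assms by (simp add: subsequence_def upt_conv_Cons)
  moreover have "n - 1 \<le> length (morph beta (w [1 \<rightarrow> n]))"
    using length_morph_beta[of "w [1 \<rightarrow> n]"] by simp
  ultimately show ?thesis
    using assms by (simp add: morph_append) (simp add: morph_def)
qed

lemma b3_unique_ex: "\<exists>!w. w 0 = L0 \<and> morph_word beta w = w"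
proof (rule ex_ex1I)
  define P where "P k = (morph beta ^^ k) [L0]" for k
  have P_Suc: "P (Suc k) = morph beta (P k)" for k
    by (simp add: P_def)
  have step: "\<exists>r. r \<noteq> [] \<and> P (Suc k) = P k @ r" for k
  proof (induction k)
    case 0
    then show ?case by (simp add: P_def morph_def)
  next
    case (Suc k)
    then obtain r where r: "r \<noteq> []" "P (Suc k) = P k @ r" by blast
    have "P (Suc (Suc k)) = P (Suc k) @ morph beta r"
      using r(2) by (metis P_Suc morph_append)
    moreover have "morph beta r \<noteq> []"
      using length_morph_beta[of r] r(1) by auto
    ultimately show ?case by blast
  qed
  have len: "k < length (P k)" for k
  proof (induction k)
    case 0
    then show ?case by (simp add: P_def)
  next
    case (Suc k)
    obtain r where "r \<noteq> []" "P (Suc k) = P k @ r" using step by blast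
    then show ?case using Suc by (cases r) auto
  qed
  have nth: "P (k + d) ! n = P k ! n" if "n < length (P k)" for k d n
  proof -
    have "\<exists>s. P (k + d) = P k @ s"
    proof (induction d)
      case (Suc d)
      then show ?case using step[of "k + d"] by auto
    qed simp
    then show ?thesis using that by (auto simp: nth_append)
  qed
  define w where "w n = P n ! n" for n
  have w_nth: "w i = P n ! i" if "i \<le> n" for i n
    using nth[of i i "n - i"] len[of i] that by (simp add: w_def)
  have "morph_word beta w n = w n" for n
  proof -
    have pre: "w [0 \<rightarrow> Suc n] = take (Suc n) (P n)"
      using len[of n] by (intro nth_equalityI) (auto simp: subsequence_def w_nth simp del: upt_Suc)
    have "P (Suc n) = morph beta (take (Suc n) (P n)) @ morph beta (drop (Suc n) (P n))"
      by (metis P_Suc morph_append append_take_drop_id)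
    moreover have "n < length (morph beta (take (Suc n) (P n)))"
      using length_morph_beta[of "take (Suc n) (P n)"] len[of n] by simp
    ultimately show ?thesis
      unfolding morph_word_def pre by (simp add: nth_append w_nth[of n "Suc n"])
  qed
  moreover have "w 0 = L0" by (simp add: w_def P_def)
  ultimately show "\<exists>w. w 0 = L0 \<and> morph_word beta w = w" by blast
next
  fix v w :: "letter word"
  assume v: "v 0 = L0 \<and> morph_word beta v = v" and w: "w 0 = L0 \<and> morph_word beta w = w"
  have key: "u n = morph beta (u [0 \<rightarrow> n]) ! n"
    if "u 0 = L0 \<and> morph_word beta u = u" "n > 0" for u n
  proof -
    have "u n = morph beta (u [0 \<rightarrow> Suc n]) ! n"
      using that(1) by (metis morph_word_def)
    also have "u [0 \<rightarrow> Suc n] = u [0 \<rightarrow> n] @ [u n]"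
      by (simp add: subsequence_def)
    finally show ?thesis
      using length_morph_beta_prefix[of u n] that by (simp add: morph_append nth_append)
  qed
  have "v n = w n" for n
  proof (induction n rule: less_induct)
    case (less n)
    then have "v [0 \<rightarrow> n] = w [0 \<rightarrow> n]" by (simp add: subsequence_def)
    then show ?case using key[OF v] key[OF w] v w by (cases "n = 0") auto
  qed
  then show "v = w" by blast
qed

lemma b3_fixed_point: "b3 0 = L0" "morph_word beta b3 = b3"
  using theI'[OF b3_unique_ex] unfolding b3_def by blast+

end

theory Submission
  imports Defs
begin

text \<open>
  By the upper bounds on \<open>f\<close>, the word \<open>w\<close> avoids \<open>ABCA.ABA.ACA.ACB.CBA\<close> or \<open>ABCA.ABA.ABCBA.ACB\<close>.
  A square \<open>uu\<close> in a recurrent word yields a factor \<open>uu y uu p uu y uu\<close>, in which both formulas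
  occur, so \<open>w\<close> is square-free. Backtracking shows that certain finite sets of words are
  unavoidable for square-free ternary words; combined with the occurrences that map variables to
  letters, they force some letter \<open>y\<close> never to be the middle of a factor \<open>xyx\<close>. After a power
  of \<open>sigma\<close> this letter is 1, so that 010 and 212 are missing. By Thue's argument such a language
  is uniquely desubstituted by \<open>beta\<close> into a language with the same properties. Iterating
  downwards, every factor of \<open>w\<close> comes from a short factor, hence lies in \<open>b3\<close>; iterating
  upwards, all words \<open>beta^k(0)\<close>, hence all factors of \<open>b3\<close>, lie in \<open>w\<close>.
\<close>

lemma append_Cons_eq: "p @ [x] = q \<Longrightarrow> p @ x # t = q @ t"
  by auto

section \<open>Square-free languages\<close>

text \<open>Models the factor set of a recurrent square-free word; left extendability is what
  recurrence leaves behind. Working with languages allows desubstitution without building a preimage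
  word.\<close>

locale sqfree_language =
  fixes F :: "'a list set"
  assumes Nil_in: "[] \<in> F"
    and factor_closed: "p @ u @ q \<in> F \<Longrightarrow> u \<in> F"
    and left_extendable: "u \<in> F \<Longrightarrow> \<exists>x. x # u \<in> F"
    and right_extendable: "u \<in> F \<Longrightarrow> \<exists>x. u @ [x] \<in> F"
    and square_free: "u @ u \<in> F \<Longrightarrow> u = []"
begin

lemma factor_in: "v \<in> F \<Longrightarrow> v = p @ u @ q \<Longrightarrow> u \<in> F"
  using factor_closed[of p u q] by simp

lemma no_square: "p @ u @ u @ q \<in> F \<Longrightarrow> u = []"
  using factor_closed[of p "u @ u" q] square_free[of u] by simp

lemma adjacent_distinct: "p @ x # y # q \<in> F \<Longrightarrow> x \<noteq> y"
  using no_square[of p "[x]" q] by auto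

lemma extend_right: "u \<in> F \<Longrightarrow> \<exists>s. length s = n \<and> u @ s \<in> F"
proof (induction n)
  case (Suc n)
  then obtain s where "length s = n" "u @ s \<in> F" by blast
  moreover from this obtain x where "(u @ s) @ [x] \<in> F" using right_extendable by blast
  ultimately show ?case by (intro exI[of _ "s @ [x]"]) simp
qed simp

end

lemma sqfree_language_rename:
  assumes "sqfree_language F" and "bij r"
  shows "sqfree_language {u. map r u \<in> F}"
proof -
  interpret sqfree_language F by fact
  have surj: "surj r" using \<open>bij r\<close> by (rule bij_is_surj)
  show ?thesis
  proof
    fix u assume u: "u \<in> {u. map r u \<in> F}"
    obtain x where x: "x # map r u \<in> F" using left_extendable u by blast
    obtain y where "x = r y" using surjD[OF surj] by blast
    then show "\<exists>x. x # u \<in> {u. map r u \<in> F}" using x by auto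
  next
    fix u assume u: "u \<in> {u. map r u \<in> F}"
    obtain x where x: "map r u @ [x] \<in> F" using right_extendable u by blast
    obtain y where "x = r y" using surjD[OF surj] by blast
    then show "\<exists>x. u @ [x] \<in> {u. map r u \<in> F}" using x by auto
  next
    show "u = []" if "u @ u \<in> {u. map r u \<in> F}" for u
      using square_free[of "map r u"] that by simp
    show "u \<in> {u. map r u \<in> F}" if "p @ u @ q \<in> {u. map r u \<in> F}" for p u q
      using factor_closed[of "map r p" "map r u" "map r q"] that by simp
  qed (simp add: Nil_in)
qed

section \<open>Desubstitution\<close>

locale thue_language = sqfree_language F for F :: "letter list set" +
  assumes no_010: "[L0, L1, L0] \<notin> F"
    and no_212: "[L2, L1, L2] \<notin> F"
begin

lemma no_010': "p @ L0 # L1 # L0 # q \<notin> F"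
  using factor_in[of _ p "[L0, L1, L0]" q] no_010 by auto

lemma no_212': "p @ L2 # L1 # L2 # q \<notin> F"
  using factor_in[of _ p "[L2, L1, L2]" q] no_212 by auto

lemma L0_L1_L2: "p @ L0 # L1 # z # q \<in> F \<Longrightarrow> z = L2"
  using no_010'[of p q] adjacent_distinct[of "p @ [L0]" L1 z q] by (cases z) auto

text \<open>An occurrence of a letter other than \<open>L0\<close> that is not the \<open>L1\<close> of \<open>L1 L2\<close> ends a block of
  \<open>beta\<close>, and the word to its right is then read off block by block.\<close>

lemma decode_right:
  assumes "p @ x # t \<in> F" and "x \<noteq> L0" and "\<not> (x = L1 \<and> t \<noteq> [] \<and> hd t = L2)"
  shows "\<exists>v. Sublist.prefix t (morph beta v) \<and> p @ x # morph beta v \<in> F \<and>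
    (v = [] \<or> length (morph beta (butlast v)) < length t)"
  using assms
proof (induction t arbitrary: p x rule: length_induct)
  case (1 t)
  note F = 1(2)
  \<comment> \<open>A whole block \<open>beta a\<close> is read off; its last letter takes over the
    role of \<open>x\<close> for the rest \<open>s\<close>.\<close>
  have step: ?case
    if t: "t = beta a @ s" and s: "\<not> (last (beta a) = L1 \<and> s \<noteq> [] \<and> hd s = L2)" for a s
  proof -
    have ab: "last (beta a) \<noteq> L0" "beta a \<noteq> []" by (cases a; simp)+
    have e: "butlast (beta a) @ last (beta a) # r = beta a @ r" for r by (cases a) simp_all
    have "(p @ x # butlast (beta a)) @ last (beta a) # s \<in> F"
      using F t by (simp add: e)
    moreover have "length s < length t" using t ab(2) by simp
    ultimately obtain v where v: "Sublist.prefix s (morph beta v)"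
      "(p @ x # butlast (beta a)) @ last (beta a) # morph beta v \<in> F"
      "v = [] \<or> length (morph beta (butlast v)) < length s"
      using 1(1)[rule_format, of s "p @ x # butlast (beta a)" "last (beta a)"] s ab(1) by blast
    have "p @ x # morph beta (a # v) \<in> F"
      using v(2) by (simp add: morph_def e)
    moreover have "Sublist.prefix t (morph beta (a # v))" using t v(1) by (simp add: morph_def)
    moreover have "length (morph beta (butlast (a # v))) < length t"
      using v(3) t ab(2) by (auto simp: morph_def)
    ultimately show ?thesis by blast
  qed
  \<comment> \<open>\<open>t\<close> stops inside \<open>beta L0\<close>: since 01 can only be
    followed by 2, right extension completes the block.\<close>
  have L012: ?case if pF: "p @ x # [L0, L1] \<in> F" and t: "t = [L0] \<or> t = [L0, L1]"
  proof -
    obtain z where "p @ x # [L0, L1, z] \<in> F" using right_extendable[OF pF] by auto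
    then have "p @ x # [L0, L1, L2] \<in> F" using L0_L1_L2[of "p @ [x]" z "[]"] by auto
    then show ?thesis using t by (intro exI[of _ "[L0]"]) (auto simp: morph_def)
  qed
  show ?case
  proof (cases t)
    case Nil
    then show ?thesis using F by (intro exI[of _ "[]"]) (simp add: morph_def)
  next
    case (Cons y t')
    show ?thesis
    proof (cases y)
      case L1
      have x: "x = L2" using adjacent_distinct[of p x y t'] F Cons L1 1(3) by (cases x) auto
      have "\<not> (t' \<noteq> [] \<and> hd t' = L2)"
        using no_212'[of p "tl t'"] F Cons L1 x by (cases t') auto
      then show ?thesis using step[of L2 t'] Cons L1 by simp
    next
      case L2
      have "x \<noteq> L2" using adjacent_distinct[of p x y t'] F Cons L2 by auto
      then show ?thesis using 1(3,4) Cons L2 by (cases x) auto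
    next
      case L0
      show ?thesis
      proof (cases t')
        case Nil
        obtain z where z: "p @ x # [L0, z] \<in> F"
          using right_extendable[OF F] Nil Cons L0 by auto
        have "z \<noteq> L0" using adjacent_distinct[of "p @ [x]" L0 z "[]"] z by auto
        then consider "z = L1" | "z = L2" by (cases z) auto
        then show ?thesis
        proof cases
          case 1
          then show ?thesis using L012 z Nil Cons L0 by simp
        next
          case 2
          then show ?thesis
            using z Nil Cons L0 by (intro exI[of _ "[L1]"]) (auto simp: morph_def)
        qed
      next
        case t': (Cons z t'')
        have "z \<noteq> L0" using adjacent_distinct[of "p @ [x]" L0 z t''] F Cons L0 t' by auto
        then consider "z = L1" | "z = L2" by (cases z) auto
        then show ?thesis
        proof cases
          case 2
          then show ?thesis using step[of L1 t''] Cons L0 t' by simp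
        next
          case z: 1
          show ?thesis
          proof (cases t'')
            case Nil
            then show ?thesis using L012 F Cons L0 t' z by simp
          next
            case (Cons z' s)
            have "z' = L2"
              using L0_L1_L2[of "p @ [x]" z' s] F \<open>t = y # t'\<close> L0 t' z Cons by auto
            then show ?thesis using step[of L0 s] \<open>t = y # t'\<close> L0 t' z Cons by simp
          qed
        qed
      qed
    qed
  qed
qed

text \<open>At most three letters to the left of \<open>u\<close> there is a letter that ends a
  block; \<open>p\<close> is the part of a block that the start of \<open>u\<close> cuts off. If
  \<open>u\<close> starts with the \<open>L2\<close> of a factor 12, the absence of 212 puts a 0
  before it, so the block is \<open>beta L0\<close>.\<close>

lemma decode_left:
  assumes "u \<in> F" and "u \<noteq> []"
  obtains x p where "x # p @ u \<in> F" and "x \<noteq> L0" and "\<not> (x = L1 \<and> hd (p @ u) = L2)"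
    and "p = [] \<or> p = [L0] \<or> p = [L0, L1]"
proof -
  obtain y where y: "y # u \<in> F" using left_extendable assms(1) by blast
  obtain y' where y': "y' # y # u \<in> F" using left_extendable y by blast
  obtain y'' where y'': "y'' # y' # y # u \<in> F" using left_extendable y' by blast
  have d: "y \<noteq> hd u" "y' \<noteq> y" "y'' \<noteq> y'"
    using adjacent_distinct[of "[]" y "hd u" "tl u"] adjacent_distinct[of "[]" y' y u]
      adjacent_distinct[of "[]" y'' y' "y # u"] y y' y'' assms(2) by auto
  show ?thesis
  proof (cases "y = L0")
    case True
    then show ?thesis using that[of y' "[L0]"] y' d by auto
  next
    case False
    show ?thesis
    proof (cases "y = L1 \<and> hd u = L2")
      case True
      then have "y' \<noteq> L2" using no_212'[of "[]" "tl u"] y' assms(2) by (cases u) auto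
      then have "y' = L0" using d True by (cases y') auto
      then show ?thesis using that[of y'' "[L0, L1]"] y'' d True by auto
    next
      case False
      then show ?thesis using that[of y "[]"] y \<open>y \<noteq> L0\<close> by auto
    qed
  qed
qed

text \<open>The letter \<open>x\<close> in front forces \<open>morph beta u\<close> to start at a block boundary: otherwise an
  initial \<open>L1\<close> could be the middle of \<open>beta L0\<close> instead of \<open>beta L2\<close>.\<close>

definition desub :: "letter list set" where
  "desub = {u. \<exists>x. x \<noteq> L0 \<and> x # morph beta u \<in> F}"

section \<open>Properties of the desubstituted language\<close>

lemma morph_desub: "u \<in> desub \<Longrightarrow> morph beta u \<in> F"
  unfolding desub_def using factor_in[of _ "[_]" "morph beta u" "[]"] by auto

lemma last_morph_beta: "u \<noteq> [] \<Longrightarrow> last (morph beta u) \<noteq> L0"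
proof (induction u rule: rev_induct)
  case (snoc a u)
  then show ?case by (cases a) (auto simp: morph_def)
qed simp

lemma hd_morph_beta: "u \<noteq> [] \<Longrightarrow> hd (morph beta u) \<noteq> L2"
  by (cases u; cases "hd u") (auto simp: morph_def)

lemma morph_beta_eq_Nil: "morph beta u = [] \<longleftrightarrow> u = []"
  by (cases u; cases "hd u") (auto simp: morph_def)

text \<open>Extend the image to the right and decode from its last letter, or from \<open>x\<close>
  if \<open>u\<close> is empty: the first decoded block gives the new letter.\<close>

lemma desub_right:
  assumes "u \<in> desub"
  shows "\<exists>a. u @ [a] \<in> desub"
proof -
  obtain x where x: "x \<noteq> L0" "x # morph beta u \<in> F" using assms unfolding desub_def by blast
  obtain y where y: "x # morph beta u @ [y] \<in> F" using right_extendable[OF x(2)] by auto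
  obtain z where z: "x # morph beta u @ [y, z] \<in> F" using right_extendable[OF y] by auto
  have goal: ?thesis
    if pF: "p @ x' # t \<in> F" and px: "p @ [x'] = x # morph beta u" and x': "x' \<noteq> L0"
      and b: "\<not> (x' = L1 \<and> hd t = L2)" and t: "t \<noteq> []"
    for p x' t
  proof -
    obtain v where v: "Sublist.prefix t (morph beta v)" "p @ x' # morph beta v \<in> F"
      using decode_right[OF pF x'] b by blast
    obtain a v' where v': "v = a # v'" using v(1) t by (cases v) (auto simp: morph_def)
    have "x # morph beta (u @ v) \<in> F"
      using v(2) append_Cons_eq[OF px] by (simp add: morph_append)
    then have "x # morph beta (u @ [a]) \<in> F"
      using factor_in[of _ "[]" "x # morph beta (u @ [a])" "morph beta v'"] v'
      by (simp add: morph_def)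
    then show ?thesis unfolding desub_def using x(1) by blast
  qed
  show ?thesis
  proof (cases u rule: rev_cases)
    case Nil
    show ?thesis
    proof (cases "x = L1 \<and> y = L2")
      case False
      then show ?thesis using goal[of "[]" x "[y]"] y Nil x(1) by (simp add: morph_def)
    next
      case True
      \<comment> \<open>An \<open>L1\<close> before \<open>L2\<close> is the middle of
        \<open>beta L0\<close>, so \<open>x\<close> is not at a block boundary. The
        \<open>L2\<close> replaces it as front letter, which is why a second letter \<open>z\<close>
        was added.\<close>
      then have "L2 # [z] \<in> F" using z Nil factor_in[of _ "[x]" "[L2, z]" "[]"] by (simp add: morph_def)
      then obtain v where v: "Sublist.prefix [z] (morph beta v)" "L2 # morph beta v \<in> F"
        using decode_right[of "[]" L2 "[z]"] by auto
      then obtain a v' where "v = a # v'" by (cases v) (auto simp: morph_def)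
      then have "L2 # morph beta [a] \<in> F"
        using v(2) factor_in[of _ "[]" "L2 # morph beta [a]" "morph beta v'"] by (simp add: morph_def)
      then show ?thesis unfolding desub_def using Nil by auto
    qed
  next
    case (snoc u' a)
    \<comment> \<open>Only \<open>beta L2\<close> ends in 1. The letter \<open>l\<close> before it
      is not 0, so a following 2 would give 212 or the square 11.\<close>
    have edge: "\<not> (last (beta a) = L1 \<and> y = L2)"
    proof
      assume "last (beta a) = L1 \<and> y = L2"
      then have a: "a = L2" "y = L2" by (cases a; simp)+
      define p where "p = butlast (x # morph beta u')"
      define l where "l = last (x # morph beta u')"
      have pl: "p @ [l] = x # morph beta u'" unfolding p_def l_def by simp
      have "l \<noteq> L0" using x(1) last_morph_beta[of u'] unfolding l_def by (auto simp: morph_beta_eq_Nil)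
      have "p @ l # L1 # [L2] \<in> F"
        using y snoc a unfolding append_Cons_eq[OF pl] by (simp add: morph_def)
      then show False
        using no_212'[of p "[]"] adjacent_distinct[of p l L1 "[L2]"] \<open>l \<noteq> L0\<close> by (cases l) auto
    qed
    have m: "last (morph beta u) = last (beta a)" "morph beta u \<noteq> []"
      using snoc by (cases a; simp add: morph_def)+
    have "(x # butlast (morph beta u)) @ last (morph beta u) # [y] \<in> F"
      using y unfolding append_Cons append_Cons_eq[OF append_butlast_last_id[OF m(2)]] .
    then show ?thesis
    proof (rule goal)
      show "(x # butlast (morph beta u)) @ [last (morph beta u)] = x # morph beta u"
        using m(2) by simp
      show "last (morph beta u) \<noteq> L0" using last_morph_beta[of u] snoc by simp
    qed (use edge m(1) in simp_all)
  qed
qed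

text \<open>The block before \<open>morph beta u\<close> ends in \<open>x\<close> and is determined
  by reading leftwards: 1 is \<open>beta L2\<close>, 02 is \<open>beta L1\<close>, 012 is
  \<open>beta L0\<close>. The letter in front of it becomes the new front letter.\<close>

lemma desub_left:
  assumes "u \<in> desub"
  shows "\<exists>a. a # u \<in> desub"
proof (cases "u = []")
  case True
  then show ?thesis using desub_right[OF assms] by simp
next
  case False
  obtain x where x: "x \<noteq> L0" "x # morph beta u \<in> F" using assms unfolding desub_def by blast
  obtain b m where bm: "morph beta u = b # m" "b \<noteq> L2"
    using hd_morph_beta[OF False] False morph_beta_eq_Nil[of u] by (cases "morph beta u") auto
  obtain y where y: "y # x # morph beta u \<in> F" using left_extendable x(2) by blast
  obtain y' where y': "y' # y # x # morph beta u \<in> F" using left_extendable y by blast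
  obtain y'' where y'': "y'' # y' # y # x # morph beta u \<in> F" using left_extendable y' by blast
  have d: "y \<noteq> x" "y' \<noteq> y" "y'' \<noteq> y'" "x \<noteq> b"
    using adjacent_distinct[of "[]" y x "b # m"] adjacent_distinct[of "[]" y' y "x # b # m"]
      adjacent_distinct[of "[]" y'' y' "y # x # b # m"] adjacent_distinct[of "[y]" x b m] y y' y'' bm
    by auto
  have "(\<exists>a z. z \<noteq> L0 \<and> z # beta a @ morph beta u \<in> F)"
  proof (cases x)
    case L0
    then show ?thesis using x by simp
  next
    case L1
    then have "b = L0" using d(4) bm(2) by (cases b) auto
    then have "y \<noteq> L0" using no_010'[of "[]" m] y L1 bm by auto
    then show ?thesis using y L1 by (intro exI[of _ L2] exI[of _ y]) simp
  next
    case L2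
    show ?thesis
    proof (cases "y = L0")
      case True
      then show ?thesis using y' L2 d by (intro exI[of _ L1] exI[of _ y']) simp
    next
      case False
      then have "y = L1" using d L2 by (cases y) auto
      moreover have "y' \<noteq> L2" using no_212'[of "[]" "morph beta u"] y' L2 \<open>y = L1\<close> by auto
      ultimately have "y' = L0" using d by (cases y') auto
      then show ?thesis using y'' L2 d \<open>y = L1\<close> by (intro exI[of _ L0] exI[of _ y'']) simp
    qed
  qed
  then show ?thesis unfolding desub_def by (simp add: morph_def)
qed

text \<open>The missing words are inherited. The image 01202012 of 010 contains the square 2020. The
  word 212 extends to 212a with a in {0,1}; its image starts with 10210, and the front letter can
  only be 2, which yields the square 210210.\<close>

lemma desub_thue_language: "thue_language desub"
proof
  show "[] \<in> desub"
  proof -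
    obtain s where s: "length s = 2" "s \<in> F" using extend_right[OF Nil_in, of 2] by auto
    then obtain a b where ab: "s = [a, b]" by (auto simp: length_Suc_conv numeral_2_eq_2)
    have "a \<noteq> b" using adjacent_distinct[of "[]" a b "[]"] s ab by auto
    moreover have "[a] \<in> F" "[b] \<in> F"
      using factor_in[OF s(2), of "[]" "[a]" "[b]"] factor_in[OF s(2), of "[a]" "[b]" "[]"] ab by auto
    ultimately show ?thesis unfolding desub_def
      by (cases "a = L0") (auto simp: morph_def intro: exI[of _ a] exI[of _ b])
  qed
  show "u \<in> desub" if pq: "p @ u @ q \<in> desub" for p u q
  proof -
    obtain x where x: "x \<noteq> L0" "x # morph beta (p @ u @ q) \<in> F" using pq unfolding desub_def by blast
    \<comment> \<open>The last letter before \<open>morph beta u\<close> is the front letter for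
      \<open>u\<close>; no block ends in 0.\<close>
    define l where "l = last (x # morph beta p)"
    have "l \<noteq> L0" using x(1) last_morph_beta[of p] unfolding l_def by (auto simp: morph_beta_eq_Nil)
    moreover have "x # morph beta (p @ u @ q) = butlast (x # morph beta p) @ (l # morph beta u) @ morph beta q"
    proof -
      have "butlast (x # morph beta p) @ [l] = x # morph beta p" unfolding l_def by simp
      from append_Cons_eq[OF this, of "morph beta u @ morph beta q"] show ?thesis
        by (simp only: morph_append append_Cons append.assoc)
    qed
    ultimately show ?thesis unfolding desub_def using factor_in[OF x(2)] by blast
  qed
  show "u = []" if "u @ u \<in> desub" for u
    using morph_desub[OF that] square_free[of "morph beta u"] by (simp add: morph_append morph_beta_eq_Nil)
  show "[L0, L1, L0] \<notin> desub"
  proof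
    assume "[L0, L1, L0] \<in> desub"
    from morph_desub[OF this] show False
      using no_square[of "[L0, L1]" "[L2, L0]" "[L1, L2]"] by (simp add: morph_def)
  qed
  show "[L2, L1, L2] \<notin> desub"
  proof
    assume "[L2, L1, L2] \<in> desub"
    then obtain a where a: "[L2, L1, L2, a] \<in> desub" using desub_right by force
    then obtain x where x: "x \<noteq> L0" "x # morph beta [L2, L1, L2, a] \<in> F" unfolding desub_def by blast
    have "x = L2" using x adjacent_distinct[of "[]" x L1] by (cases x) (auto simp: morph_def)
    moreover have "a \<noteq> L2" using x adjacent_distinct[of "[x, L1, L0, L2]" L1 L1 "[]"] by (auto simp: morph_def)
    ultimately show False
      using x no_square[of "[]" "[L2, L1, L0]"] by (cases a) (auto simp: morph_def)
  qed
qed (rule desub_left desub_right, assumption)+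

text \<open>Makes the downward induction on length terminate. Write \<open>v\<close> as
  \<open>a # m @ [z]\<close>. The outer two blocks each share a letter with \<open>u\<close>, so
  \<open>morph beta m\<close> is at least two letters shorter than \<open>u\<close>. Two adjacent
  letters of \<open>m\<close> are distinct, so one of their blocks is longer than 1 and
  \<open>m\<close> is shorter than its image; if \<open>m\<close> has at most one letter, the bound
  4 suffices.\<close>

lemma desub_cover:
  assumes "u \<in> F" and "4 \<le> length u"
  obtains v where "v \<in> desub" and "sublist u (morph beta v)" and "length v < length u"
proof -
  interpret D: thue_language desub by (rule desub_thue_language)
  have une: "u \<noteq> []" using assms(2) by (cases u) simp_all
  obtain x p where x: "x # p @ u \<in> F" "x \<noteq> L0" "\<not> (x = L1 \<and> hd (p @ u) = L2)"
    and p: "p = [] \<or> p = [L0] \<or> p = [L0, L1]"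
    using decode_left[OF assms(1) une] by blast
  obtain v where v: "Sublist.prefix (p @ u) (morph beta v)" "[] @ x # morph beta v \<in> F"
    "v = [] \<or> length (morph beta (butlast v)) < length (p @ u)"
    using decode_right[of "[]" x "p @ u"] x by auto
  have vD: "v \<in> desub" using v(2) x(2) unfolding desub_def by auto
  have sub: "sublist u (morph beta v)"
    using v(1) by (auto simp: prefix_def)
  have "length v < length u"
  proof (cases "length v \<le> 1")
    case True
    then show ?thesis using assms(2) by simp
  next
    case False
    then obtain a v' where v': "v = a # v'" "v' \<noteq> []" by (cases v) auto
    then obtain m z where amz: "v = a # m @ [z]" by (cases v' rule: rev_cases) auto
    have pa: "length p < length (beta a)"
      using v(1) p une by (cases a; cases u) (auto simp: amz morph_def)
    have "length (beta a) + length (morph beta m) < length p + length u"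
      using v(3) amz by (simp add: morph_def butlast_append)
    then have m: "length (morph beta m) + 2 \<le> length u" using pa by simp
    show ?thesis
    proof (cases "length m \<le> 1")
      case True
      then show ?thesis using assms(2) amz by simp
    next
      case False
      then obtain b c m' where bc: "m = b # c # m'"
        by (cases m; cases "tl m") auto
      have "b \<noteq> c" using D.adjacent_distinct[of "[a]" b c "m' @ [z]"] vD amz bc by auto
      then have "length m < length (morph beta m)"
        using length_morph_beta[of m'] bc by (cases b; cases c) (auto simp: morph_def)
      then show ?thesis using m amz by simp
    qed
  qed
  then show ?thesis using that vD sub by blast
qed

lemma L0_in: "[L0] \<in> F"
proof -
  obtain s where s: "length s = Suc (Suc (Suc (Suc 0)))" "s \<in> F"
    using extend_right[OF Nil_in] by (metis append_Nil)
  then obtain a b c d where abcd: "s = [a, b, c, d]"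
    unfolding length_Suc_conv by blast
  have "a \<noteq> b" "b \<noteq> c" "c \<noteq> d" "\<not> (a = c \<and> b = d)"
    using s(2) adjacent_distinct[of "[]" a b "[c, d]"] adjacent_distinct[of "[a]" b c "[d]"]
      adjacent_distinct[of "[a, b]" c d "[]"] no_square[of "[]" "[a, b]" "[]"] abcd by auto
  \<comment> \<open>Every word of length 4 over two letters contains a square.\<close>
  then have "L0 \<in> set s"
    unfolding abcd by (cases a; cases b; cases c; cases d; simp)
  then obtain p q where "s = p @ [L0] @ q" by (auto dest: split_list)
  then show ?thesis using factor_closed s(2) by blast
qed

end

text \<open>\<open>F\<close> varies because the induction hypothesis is applied to the desubstituted
  language of \<open>F\<close>.\<close>

lemma beta_power_in_thue_language: "thue_language F \<Longrightarrow> (morph beta ^^ k) [L0] \<in> F"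
proof (induction k arbitrary: F)
  case 0
  then show ?case using thue_language.L0_in by simp
next
  case (Suc k)
  then show ?case
    using thue_language.desub_thue_language thue_language.morph_desub by fastforce
qed

section \<open>Factors of infinite words\<close>

lemma subsequence_split: "i \<le> j \<Longrightarrow> j \<le> k \<Longrightarrow> w [i \<rightarrow> k] = w [i \<rightarrow> j] @ w [j \<rightarrow> k]"
  using upt_add_eq_append[of i j "k - j"] by (simp add: subsequence_def flip: map_append)

lemma subsequence_in_factors: "i \<le> j \<Longrightarrow> w [i \<rightarrow> j] \<in> factors w"
  unfolding factors_def by blast

lemma factors_iff: "u \<in> factors w \<longleftrightarrow> (\<exists>i. w [i \<rightarrow> i + length u] = u)"
proof
  assume "u \<in> factors w"
  then obtain i j where "i \<le> j" "u = w [i \<rightarrow> j]" unfolding factors_def by blast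
  then show "\<exists>i. w [i \<rightarrow> i + length u] = u" by (intro exI[of _ i]) simp
next
  assume "\<exists>i. w [i \<rightarrow> i + length u] = u"
  then obtain i where "w [i \<rightarrow> i + length u] = u" by blast
  then show "u \<in> factors w" using subsequence_in_factors[of i "i + length u" w] by simp
qed

lemma Nil_in_factors: "[] \<in> factors w"
  by (simp add: factors_iff)

lemma factors_factor:
  assumes "p @ u @ q \<in> factors w"
  shows "u \<in> factors w"
proof -
  obtain i where i: "w [i \<rightarrow> i + length (p @ u @ q)] = p @ u @ q" using assms factors_iff by blast
  let ?j = "i + length p" and ?k = "i + length p + length u"
  have "p @ u @ q = w [i \<rightarrow> ?j] @ w [?j \<rightarrow> ?k] @ w [?k \<rightarrow> i + length (p @ u @ q)]"
    using i subsequence_split[of i ?j "i + length (p @ u @ q)" w]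
      subsequence_split[of ?j ?k "i + length (p @ u @ q)" w] by simp
  then have "w [?j \<rightarrow> ?k] = u" by (simp add: append_eq_append_conv)
  then show ?thesis unfolding factors_iff by blast
qed

lemma factors_sublist: "sublist u v \<Longrightarrow> v \<in> factors w \<Longrightarrow> u \<in> factors w"
  using factors_factor[of _ u _ w] by (auto simp: sublist_def)

lemma factors_extend_right: "u \<in> factors w \<Longrightarrow> \<exists>x. u @ [x] \<in> factors w"
proof -
  assume "u \<in> factors w"
  then obtain i where i: "w [i \<rightarrow> i + length u] = u" using factors_iff by blast
  have "w [i \<rightarrow> i + length (u @ [w (i + length u)])] = u @ [w (i + length u)]"
    using subsequence_split[of i "i + length u" "Suc (i + length u)" w] i by simp
  then show ?thesis unfolding factors_iff by blast
qed

lemma recurrent_at: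
  assumes "recurrent w" and "u \<in> factors w"
  obtains i where "n \<le> i" and "w [i \<rightarrow> i + length u] = u"
proof -
  have "infinite {i. w [i \<rightarrow> i + length u] = u}" using assms unfolding recurrent_def by blast
  then show ?thesis using that unfolding infinite_nat_iff_unbounded_le by blast
qed

lemma recurrent_extend_left:
  assumes "recurrent w" and "u \<in> factors w"
  shows "\<exists>x. x # u \<in> factors w"
proof -
  obtain i where i: "1 \<le> i" "w [i \<rightarrow> i + length u] = u" using recurrent_at[OF assms] by blast
  then obtain k where k: "i = Suc k" by (cases i) auto
  have "w [k \<rightarrow> k + length (w k # u)] = w k # u"
    using subsequence_split[of k "Suc k" "k + length (w k # u)" w] i k by simp
  then show ?thesis unfolding factors_iff by blast
qed

lemma recurrent_repeat:
  assumes "recurrent w" and "u \<in> factors w"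
  shows "\<exists>y. u @ y @ u \<in> factors w"
proof -
  obtain i where i: "w [i \<rightarrow> i + length u] = u" using assms(2) factors_iff by blast
  obtain j where j: "i + length u \<le> j" "w [j \<rightarrow> j + length u] = u"
    using recurrent_at[OF assms] by blast
  have "w [i \<rightarrow> j + length u] = u @ w [i + length u \<rightarrow> j] @ u"
    using subsequence_split[of i "i + length u" "j + length u" w]
      subsequence_split[of "i + length u" j "j + length u" w] i j by simp
  then show ?thesis
    using subsequence_in_factors[of i "j + length u" w] j by (intro exI[of _ "w [i + length u \<rightarrow> j]"]) simp
qed

lemma factors_comp: "factors (r \<circ> w) = map r ` factors w"
proof -
  have "(r \<circ> w) [i \<rightarrow> j] = map r (w [i \<rightarrow> j])" for i j by (simp add: subsequence_def)
  then show ?thesis unfolding factors_def by auto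
qed

section \<open>Factors of \<open>b3\<close> and powers of \<open>beta\<close>\<close>

lemma b3_prefix: "morph beta (b3 [0 \<rightarrow> n]) = b3 [0 \<rightarrow> length (morph beta (b3 [0 \<rightarrow> n]))]"
proof (rule nth_equalityI)
  fix i assume i: "i < length (morph beta (b3 [0 \<rightarrow> n]))"
  have b: "b3 i = morph beta (b3 [0 \<rightarrow> Suc i]) ! i"
    using fun_cong[OF b3_fixed_point(2), of i] unfolding morph_word_def by simp
  have li: "i < length (morph beta (b3 [0 \<rightarrow> Suc i]))"
    using length_morph_beta[of "b3 [0 \<rightarrow> Suc i]"] by simp
  \<comment> \<open>Images of two prefixes agree wherever both are defined. So the letter at
    \<open>i\<close>, which the fixed point equation reads from the prefix of length
    \<open>i + 1\<close>, can be read from any image that reaches beyond \<open>i\<close>.\<close>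
  have split: "morph beta (b3 [0 \<rightarrow> k]) ! i = morph beta (b3 [0 \<rightarrow> m]) ! i"
    if "m \<le> k" "i < length (morph beta (b3 [0 \<rightarrow> m]))" for m k
    using subsequence_split[of 0 m k b3] that by (simp add: morph_append nth_append)
  have "morph beta (b3 [0 \<rightarrow> n]) ! i = morph beta (b3 [0 \<rightarrow> Suc i]) ! i"
    using split[OF _ i] split[OF _ li] by (metis nat_le_linear)
  also have "\<dots> = b3 i" by (rule b[symmetric])
  finally have "morph beta (b3 [0 \<rightarrow> n]) ! i = b3 i" .
  then show "morph beta (b3 [0 \<rightarrow> n]) ! i = b3 [0 \<rightarrow> length (morph beta (b3 [0 \<rightarrow> n]))] ! i"
    using i by (simp add: subsequence_def)
qed simp

lemma morph_beta_factors_b3: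
  assumes "u \<in> factors b3"
  shows "morph beta u \<in> factors b3"
proof -
  obtain i j where ij: "i \<le> j" "u = b3 [i \<rightarrow> j]" using assms unfolding factors_def by blast
  have "morph beta (b3 [0 \<rightarrow> i]) @ morph beta u @ [] = morph beta (b3 [0 \<rightarrow> j])"
    using subsequence_split[of 0 i j b3] ij by (simp add: morph_append)
  also have "\<dots> \<in> factors b3" by (subst b3_prefix) (simp add: subsequence_in_factors)
  finally show ?thesis by (rule factors_factor)
qed

lemma beta_power_prefix: "\<exists>n>k. (morph beta ^^ k) [L0] = b3 [0 \<rightarrow> n]"
proof (induction k)
  case 0
  show ?case using b3_fixed_point(1) by (intro exI[of _ 1]) (simp add: subsequence_def)
next
  case (Suc k)
  then obtain n where n: "k < n" "(morph beta ^^ k) [L0] = b3 [0 \<rightarrow> n]" by blast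
  have "n < length (morph beta (b3 [0 \<rightarrow> n]))"
    using length_morph_beta_prefix[of b3 n] b3_fixed_point(1) n by simp
  then show ?case
    using n b3_prefix[of n] by (intro exI[of _ "length (morph beta (b3 [0 \<rightarrow> n]))"]) simp
qed

lemma beta_power_in_factors_b3: "(morph beta ^^ k) [L0] \<in> factors b3"
  using beta_power_prefix[of k] subsequence_in_factors[of 0 _ b3] by force

lemma factors_b3_sublist_beta_power:
  assumes "u \<in> factors b3"
  obtains k where "sublist u ((morph beta ^^ k) [L0])"
proof -
  obtain i j where ij: "i \<le> j" "u = b3 [i \<rightarrow> j]" using assms unfolding factors_def by blast
  obtain n where n: "j < n" "(morph beta ^^ j) [L0] = b3 [0 \<rightarrow> n]" using beta_power_prefix by blast
  have "b3 [0 \<rightarrow> n] = b3 [0 \<rightarrow> i] @ u @ b3 [j \<rightarrow> n]"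
    using subsequence_split[of 0 i n b3] subsequence_split[of i j n b3] ij n by simp
  then show ?thesis using that[of j] n(2) by (simp add: sublist_appendI)
qed

lemma short_in_factors_b3:
  assumes "thue_language F" and "[a, b, c] \<in> F"
  shows "[a, b, c] \<in> factors b3"
proof -
  interpret thue_language F by fact
  have "a \<noteq> b" "b \<noteq> c" "[a, b, c] \<noteq> [L0, L1, L0]" "[a, b, c] \<noteq> [L2, L1, L2]"
    using assms(2) adjacent_distinct[of "[]" a b "[c]"] adjacent_distinct[of "[a]" b c "[]"]
      no_010 no_212 by auto
  \<comment> \<open>The ten words of length 3 without equal neighbours, other than 010 and 212, all
    occur in the fourth power.\<close>
  then have "sublist [a, b, c] (morph beta (morph beta (morph beta (morph beta [L0]))))"
    by (cases a; cases b; cases c) (simp_all add: morph_def sublist_Cons_right)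
  then show ?thesis
    using beta_power_in_factors_b3[of 4] factors_sublist by (simp add: numeral_eq_Suc)
qed

theorem thue_language_eq_factors_b3:
  assumes "thue_language F"
  shows "F = factors b3"
proof
  show "factors b3 \<subseteq> F"
  proof
    fix u assume "u \<in> factors b3"
    then obtain k where "sublist u ((morph beta ^^ k) [L0])"
      using factors_b3_sublist_beta_power by blast
    then obtain p q where "p @ u @ q = (morph beta ^^ k) [L0]" by (auto simp: sublist_def)
    then have "p @ u @ q \<in> F" using beta_power_in_thue_language[OF assms, of k] by simp
    then show "u \<in> F"
      by (rule sqfree_language.factor_closed[OF thue_language.axioms(1)[OF assms]])
  qed
  have "u \<in> factors b3" if "thue_language F" "u \<in> F" for u F
    using that
  proof (induction u arbitrary: F rule: length_induct)
    case (1 u)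
    interpret thue_language F by fact
    show ?case
    proof (cases "4 \<le> length u")
      case True
      obtain v where v: "v \<in> desub" "sublist u (morph beta v)" "length v < length u"
        using desub_cover[OF 1(3) True] by blast
      have "v \<in> factors b3" using 1(1) v(1,3) desub_thue_language by blast
      then show ?thesis using v(2) factors_sublist morph_beta_factors_b3 by blast
    next
      case False
      \<comment> \<open>Padding to length exactly 3 reduces all short words to one base
        case.\<close>
      obtain s where s: "length s = 3 - length u" "u @ s \<in> F" using extend_right[OF 1(3)] by blast
      then have "length (u @ s) = Suc (Suc (Suc 0))" using False by simp
      then obtain a b c where abc: "u @ s = [a, b, c]" unfolding length_Suc_conv by blast
      have "u @ s \<in> factors b3"
        using short_in_factors_b3[OF 1(2)] s(2) unfolding abc by blast
      then show ?thesis using factors_factor[of "[]" u s] by simp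
    qed
  qed
  then show "F \<subseteq> factors b3" using assms by blast
qed

section \<open>Unavoidable sets of ternary words\<close>

fun take_eq :: "nat \<Rightarrow> 'a list \<Rightarrow> 'a list \<Rightarrow> bool" where
  "take_eq 0 us vs = True"
| "take_eq (Suc n) (u # us) (v # vs) = (if u = v then take_eq n us vs else False)"
| "take_eq (Suc n) us vs = False"

lemma take_eq_iff:
  "take_eq n us vs \<longleftrightarrow> n \<le> length us \<and> n \<le> length vs \<and> take n us = take n vs"
  by (induction n us vs rule: take_eq.induct) auto

text \<open>The third argument is meant to be \<open>drop n us\<close>.\<close>

fun square_prefix :: "nat \<Rightarrow> 'a list \<Rightarrow> 'a list \<Rightarrow> bool" where
  "square_prefix n us [] = False"
| "square_prefix n us (v # vs) =
     (if take_eq (Suc n) us vs then True else square_prefix (Suc n) us vs)"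

lemma square_prefixD:
  assumes "square_prefix n us vs" and "vs = drop n us"
  shows "\<exists>p q. p \<noteq> [] \<and> us = p @ p @ q"
  using assms
proof (induction n us vs rule: square_prefix.induct)
  case (2 n us v vs)
  have vs: "vs = drop (Suc n) us" using 2(3) by (metis drop_Suc list.sel(3) tl_drop)
  show ?case
  proof (cases "take_eq (Suc n) us vs")
    case True
    then have "us = take (Suc n) us @ take (Suc n) us @ drop (Suc n) vs"
      by (metis append_take_drop_id take_eq_iff vs)
    moreover have "take (Suc n) us \<noteq> []" using True by (auto simp: take_eq_iff)
    ultimately show ?thesis by blast
  next
    case False
    then show ?thesis using 2 vs by simp
  qed
qed simp

text \<open>Nested conditionals instead of connectives, so that \<open>code_simp\<close> evaluates lazily and prunes
  the search.\<close>

fun dead :: "letter list list \<Rightarrow> nat \<Rightarrow> letter list \<Rightarrow> bool" where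
  "dead S 0 u = False"
| "dead S (Suc n) u =
     (if square_prefix 0 u u then True
      else if list_ex (\<lambda>s. take_eq (length s) s u) S then True
      else if dead S n (L0 # u) then if dead S n (L1 # u) then dead S n (L2 # u) else False
      else False)"

text \<open>The search extends words to the left, so a new square or forbidden word must be a
  prefix; testing prefixes is enough. If all three extensions are dead, left extendability excludes
  the word itself.\<close>

lemma dead_not_in:
  assumes "sqfree_language F" and "set S \<inter> F = {}" and "dead S n u"
  shows "u \<notin> F"
  using assms(3)
proof (induction n arbitrary: u)
  case (Suc n)
  interpret sqfree_language F by fact
  show ?case
  proof
    assume u: "u \<in> F"
    have "\<not> square_prefix 0 u u"
    proof
      assume "square_prefix 0 u u"
      then obtain p q where "p \<noteq> []" "u = p @ p @ q" using square_prefixD[of 0 u u] by auto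
      then show False using no_square[of "[]" p q] u by simp
    qed
    moreover have "\<not> list_ex (\<lambda>s. take_eq (length s) s u) S"
    proof
      assume "list_ex (\<lambda>s. take_eq (length s) s u) S"
      then obtain s where s: "s \<in> set S" "s = take (length s) u"
        by (auto simp: list_ex_iff take_eq_iff)
      then have "s \<in> F"
        using factor_in[OF u, of "[]" s "drop (length s) u"] by (metis append_Nil append_take_drop_id)
      then show False using s assms(2) by blast
    qed
    ultimately have "dead S n (L0 # u)" "dead S n (L1 # u)" "dead S n (L2 # u)"
      using Suc.prems by (auto split: if_splits)
    then have "x # u \<notin> F" for x using Suc.IH by (cases x) auto
    then show False using left_extendable[OF u] by blast
  qed
qed simp

definition rename :: "letter \<Rightarrow> letter \<Rightarrow> letter \<Rightarrow> letter \<Rightarrow> letter" where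
  "rename a b c x = (case x of L0 \<Rightarrow> a | L1 \<Rightarrow> b | L2 \<Rightarrow> c)"

lemma rename_simps [simp]: "rename a b c L0 = a" "rename a b c L1 = b" "rename a b c L2 = c"
  by (simp_all add: rename_def)

lemma bij_rename:
  assumes "distinct [a, b, c]"
  shows "bij (rename a b c)"
proof (rule bijI)
  show "inj (rename a b c)"
    using assms by (intro injI) (auto simp: rename_def split: letter.splits)
  have "y \<in> {a, b, c}" for y using assms by (cases y; cases a; cases b; cases c) auto
  moreover have "{a, b, c} \<subseteq> range (rename a b c)"
    using rangeI[of "rename a b c"] rename_simps[of a b c] by (metis empty_subsetI insert_subset)
  ultimately show "surj (rename a b c)" by blast
qed

text \<open>One search on the letters in standard order serves all six arrangements, since the
  renamed language is again square-free.\<close>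

lemma dead_unavoidable:
  assumes "sqfree_language F" and "dead S n []" and "distinct [a, b, c]"
  shows "\<exists>s \<in> set S. map (rename a b c) s \<in> F"
proof (rule ccontr)
  assume "\<not> ?thesis"
  then have "set S \<inter> {u. map (rename a b c) u \<in> F} = {}" by blast
  then have "[] \<notin> {u. map (rename a b c) u \<in> F}"
    using dead_not_in[OF sqfree_language_rename[OF assms(1) bij_rename[OF assms(3)]]] assms(2) by blast
  then show False using sqfree_language.Nil_in[OF assms(1)] by simp
qed

text \<open>The first clause supplies the fragments \<open>ACB\<close> and \<open>CBA\<close> when
  variables are mapped to distinct letters. The last serves to find the missing middle letter, the
  others to exclude the upper bounds.\<close>

lemma unavoidable:
  fixes F :: "letter list set"
  assumes "sqfree_language F" and "distinct [a, b, c]"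
  shows "[a, b, c] \<in> F"
    and "[a, b, c, a] \<in> F \<or> [a, c, b, a] \<in> F \<or> [b, c, b] \<in> F"
    and "[a, b, c, a] \<in> F \<or> [a, c, b, a] \<in> F \<or> [b, a, c, b] \<in> F"
    and "[a, b, c, a] \<in> F \<or> [a, c, b, a] \<in> F \<or> [b, a, c, a, b] \<in> F"
    and "[a, b, c, b, a] \<in> F \<or> [a, c, b, a] \<in> F"
    and "[a, b, c, b, a] \<in> F \<or> [a, c, b, c, a] \<in> F \<or> [b, a, c, b] \<in> F"
    and "[a, b, c, b, a] \<in> F \<or> [a, c, b, c, a] \<in> F \<or> [b, a, c, a, b] \<in> F"
    and "[a, c, a] \<in> F \<or> [b, a, b] \<in> F \<or> [c, b, c] \<in> F"
proof -
  note U = dead_unavoidable[OF assms(1) _ assms(2)]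
  \<comment> \<open>The number is the search depth: only words shorter than it are examined, and
    every branch closes among them.\<close>
  have "dead [[L0, L1, L2]] 31 []" by code_simp
  from U[OF this] show "[a, b, c] \<in> F" by simp
  have "dead [[L0, L1, L2, L0], [L0, L2, L1, L0], [L1, L2, L1]] 20 []" by code_simp
  from U[OF this] show "[a, b, c, a] \<in> F \<or> [a, c, b, a] \<in> F \<or> [b, c, b] \<in> F" by simp
  have "dead [[L0, L1, L2, L0], [L0, L2, L1, L0], [L1, L0, L2, L1]] 22 []" by code_simp
  from U[OF this] show "[a, b, c, a] \<in> F \<or> [a, c, b, a] \<in> F \<or> [b, a, c, b] \<in> F" by simp
  have "dead [[L0, L1, L2, L0], [L0, L2, L1, L0], [L1, L0, L2, L0, L1]] 25 []" by code_simp
  from U[OF this] show "[a, b, c, a] \<in> F \<or> [a, c, b, a] \<in> F \<or> [b, a, c, a, b] \<in> F" by simp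
  have "dead [[L0, L1, L2, L1, L0], [L0, L2, L1, L0]] 33 []" by code_simp
  from U[OF this] show "[a, b, c, b, a] \<in> F \<or> [a, c, b, a] \<in> F" by simp
  have "dead [[L0, L1, L2, L1, L0], [L0, L2, L1, L2, L0], [L1, L0, L2, L1]] 39 []" by code_simp
  from U[OF this] show "[a, b, c, b, a] \<in> F \<or> [a, c, b, c, a] \<in> F \<or> [b, a, c, b] \<in> F" by simp
  have "dead [[L0, L1, L2, L1, L0], [L0, L2, L1, L2, L0], [L1, L0, L2, L0, L1]] 27 []" by code_simp
  from U[OF this] show "[a, b, c, b, a] \<in> F \<or> [a, c, b, c, a] \<in> F \<or> [b, a, c, a, b] \<in> F" by simp
  have "dead [[L0, L2, L0], [L1, L0, L1], [L2, L1, L2]] 11 []" by code_simp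
  from U[OF this] show "[a, c, a] \<in> F \<or> [b, a, b] \<in> F \<or> [c, b, c] \<in> F" by simp
qed

section \<open>A letter that is never the middle of a factor xyx\<close>

lemma all_letter: "(\<forall>x. P x) \<longleftrightarrow> P L0 \<and> P L1 \<and> P L2"
proof (intro iffI allI)
  fix x assume "P L0 \<and> P L1 \<and> P L2"
  then show "P x" by (cases x) simp_all
qed simp

lemma ex_letter: "(\<exists>x. P x) \<longleftrightarrow> P L0 \<or> P L1 \<or> P L2"
  using all_letter[of "\<lambda>x. \<not> P x"] by blast

text \<open>Otherwise choose for each middle y an outer letter x. If two letters choose each other,
  the choice of the third contradicts \<open>avoid\<close>. If the choice is a 3-cycle, some word of
  the opposite cyclic class is present and again gives two letters that are mutually middle and
  outer.\<close>

lemma missing_middle_letter: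
  fixes F :: "letter list set"
  assumes "sqfree_language F"
    and avoid: "\<And>a b c. distinct [a, b, c] \<Longrightarrow>
      \<not> ([a, b, a] \<in> F \<and> [a, c, a] \<in> F \<and> [b, a, b] \<in> F)"
  shows "\<exists>y. \<forall>x. x \<noteq> y \<longrightarrow> [x, y, x] \<notin> F"
proof -
  have "[x, z, x] \<in> F \<or> [y, x, y] \<in> F \<or> [z, y, z] \<in> F" if "distinct [x, y, z]" for x y z
    using unavoidable(8)[OF assms(1) that] .
  \<comment> \<open>The six words xyx form two cyclic classes, each of which meets
    \<open>F\<close>.\<close>
  from this[of L0 L1 L2] this[of L1 L0 L2]
  have cyclic: "[L0, L2, L0] \<in> F \<or> [L1, L0, L1] \<in> F \<or> [L2, L1, L2] \<in> F"
    "[L1, L2, L1] \<in> F \<or> [L0, L1, L0] \<in> F \<or> [L2, L0, L2] \<in> F" by auto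
  show ?thesis
    unfolding ex_letter all_letter using cyclic avoid[of L0 L1 L2] avoid[of L0 L2 L1]
      avoid[of L1 L0 L2] avoid[of L1 L2 L0] avoid[of L2 L0 L1] avoid[of L2 L1 L0] by auto
qed

section \<open>Occurrences of formulas\<close>

text \<open>An occurrence of \<open>g\<close> composed with the morphism behind
  \<open>f \<preceq> g\<close> is an occurrence of \<open>f\<close>.\<close>

lemma avoids_divides:
  assumes "avoids w f" and "f \<preceq> g"
  shows "avoids w g"
  unfolding avoids_def
proof
  assume "\<exists>k. occurrence k g w"
  then obtain k where k: "nonerasing k" "\<And>\<psi>. \<psi> \<in> g \<Longrightarrow> morph k \<psi> \<in> factors w"
    unfolding occurrence_def by blast
  obtain h where h: "nonerasing h" "\<And>\<phi>. \<phi> \<in> f \<Longrightarrow> \<exists>\<psi> \<in> g. sublist (morph h \<phi>) \<psi>"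
    using assms(2) unfolding divides_def by blast
  have comp: "morph (morph k \<circ> h) \<phi> = morph k (morph h \<phi>)" for \<phi>
    by (induction \<phi>) (simp_all add: morph_def)
  have "occurrence (morph k \<circ> h) f w"
    unfolding occurrence_def
  proof
    show "nonerasing (morph k \<circ> h)"
      using k(1) h(1) unfolding nonerasing_def morph_def by simp
    show "\<forall>\<phi> \<in> f. morph (morph k \<circ> h) \<phi> \<in> factors w"
    proof
      fix \<phi> assume "\<phi> \<in> f"
      then obtain \<psi> p q where \<psi>: "\<psi> \<in> g" "\<psi> = p @ morph h \<phi> @ q"
        using h(2) unfolding sublist_def by blast
      then have "morph k p @ morph (morph k \<circ> h) \<phi> @ morph k q \<in> factors w"
        using k(2)[of \<psi>] by (simp add: comp morph_append)
      then show "morph (morph k \<circ> h) \<phi> \<in> factors w" by (rule factors_factor)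
    qed
  qed
  then show False using assms(1) unfolding avoids_def by blast
qed

text \<open>All characters other than A and B go to \<open>z\<close>, because
  \<open>nonerasing\<close> speaks about the whole type of characters.\<close>

lemma avoids_ABC:
  assumes "avoids w f" and "u \<noteq> []" and "v \<noteq> []" and "z \<noteq> []"
  shows "\<exists>\<phi> \<in> f. morph (\<lambda>x. if x = CHR ''A'' then u else if x = CHR ''B'' then v else z) \<phi> \<notin> factors w"
proof (rule ccontr)
  let ?h = "\<lambda>x. if x = CHR ''A'' then u else if x = CHR ''B'' then v else z"
  assume "\<not> ?thesis"
  then have "occurrence ?h f w" using assms(2-4) unfolding occurrence_def nonerasing_def by simp
  then show False using assms(1) unfolding avoids_def by blast
qed

lemma avoids_upper1:
  assumes "avoids w {''ABCA'', ''ABA'', ''ACA'', ''ACB'', ''CBA''}"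
    and "u \<noteq> []" and "v \<noteq> []" and "z \<noteq> []"
  shows "\<not> (u @ v @ z @ u \<in> factors w \<and> u @ v @ u \<in> factors w \<and> u @ z @ u \<in> factors w \<and>
    u @ z @ v \<in> factors w \<and> z @ v @ u \<in> factors w)"
  using avoids_ABC[OF assms] by (auto simp: morph_def)

lemma avoids_upper2:
  assumes "avoids w {''ABCA'', ''ABA'', ''ABCBA'', ''ACB''}"
    and "u \<noteq> []" and "v \<noteq> []" and "z \<noteq> []"
  shows "\<not> (u @ v @ z @ u \<in> factors w \<and> u @ v @ u \<in> factors w \<and>
    u @ v @ z @ v @ u \<in> factors w \<and> u @ z @ v \<in> factors w)"
  using avoids_ABC[OF assms] by (auto simp: morph_def)

lemma recurrent_square:
  assumes "recurrent w" and "u @ u \<in> factors w"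
  shows "\<exists>y p. u @ u @ y @ u @ u @ p @ u @ u @ y @ u @ u \<in> factors w"
proof -
  obtain y where "(u @ u) @ y @ (u @ u) \<in> factors w" using recurrent_repeat[OF assms] by blast
  from recurrent_repeat[OF assms(1) this] show ?thesis by auto
qed

lemma factors_sqfree_language:
  assumes "recurrent w"
    and "avoids w {''ABCA'', ''ABA'', ''ACA'', ''ACB'', ''CBA''} \<or>
      avoids w {''ABCA'', ''ABA'', ''ABCBA'', ''ACB''}"
  shows "sqfree_language (factors w)"
proof
  fix u assume uu: "u @ u \<in> factors w"
  show "u = []"
  proof (rule ccontr)
    assume u: "u \<noteq> []"
    obtain y p where "u @ u @ y @ u @ u @ p @ u @ u @ y @ u @ u \<in> factors w" (is "?s \<in> _")
      using recurrent_square[OF assms(1) uu] by blast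
    then have f: "v \<in> factors w" if "?s = a @ v @ b" for a v b
      using factors_factor[of a v b w] that by simp
    \<comment> \<open>The substitution \<open>A = u\<close>, \<open>B = u y u\<close>, \<open>C = u p u\<close> is an occurrence of both upper bounds.\<close>
    let ?v = "u @ y @ u" and ?z = "u @ p @ u"
    have "u @ ?v @ ?z @ u \<in> factors w" by (rule f[of "[]" _ "y @ u @ u"]) simp
    moreover have "u @ ?v @ u \<in> factors w" by (rule f[of "[]" _ "p @ u @ u @ y @ u @ u"]) simp
    moreover have "u @ ?z @ u \<in> factors w" by (rule f[of "u @ u @ y" _ "y @ u @ u"]) simp
    moreover have "u @ ?z @ ?v \<in> factors w" by (rule f[of "u @ u @ y" _ "u"]) simp
    moreover have "?z @ ?v @ u \<in> factors w" by (rule f[of "u @ u @ y @ u" _ "[]"]) simp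
    moreover have "u @ ?v @ ?z @ ?v @ u \<in> factors w" by (rule f[of "[]" _ "[]"]) simp
    ultimately show False
      using avoids_upper1[of w u ?v ?z] avoids_upper2[of w u ?v ?z] assms(2) u by blast
  qed
qed (fact Nil_in_factors | erule factors_factor factors_extend_right recurrent_extend_left[OF assms(1)])+

section \<open>Occurrences of the upper bounds that map variables to letters\<close>

lemma upper1_excluded:
  fixes w :: "letter word"
  assumes "sqfree_language (factors w)" and "distinct [a, b, c]"
    and "avoids w {''ABCA'', ''ABA'', ''ACA'', ''ACB'', ''CBA''}"
  shows "\<not> ([a, b, a] \<in> factors w \<and> [a, c, a] \<in> factors w \<and> [b, a, b] \<in> factors w)"
proof -
  have X: "\<not> ([x, y, z, x] \<in> factors w \<and> [x, y, x] \<in> factors w \<and> [x, z, x] \<in> factors w)"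
    if "distinct [x, y, z]" for x y z
    using avoids_upper1[OF assms(3), of "[x]" "[y]" "[z]"] unavoidable(1)[OF assms(1), of x z y]
      unavoidable(1)[OF assms(1), of z y x] that by auto
  \<comment> \<open>Given aba and aca, \<open>X\<close> excludes abca and acba. Then bcb and bacb
    are unavoidable, and together with bab they contradict \<open>X\<close> for b, a, c.\<close>
  show ?thesis
    using X[of a b c] X[of a c b] X[of b a c] unavoidable(2,3)[OF assms(1,2)] assms(2) by auto
qed

lemma upper2_excluded:
  fixes w :: "letter word"
  assumes "sqfree_language (factors w)" and "distinct [a, b, c]"
    and "avoids w {''ABCA'', ''ABA'', ''ABCBA'', ''ACB''}"
  shows "\<not> ([a, b, a] \<in> factors w \<and> [a, c, a] \<in> factors w \<and> [b, a, b] \<in> factors w)"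
proof -
  have X: "\<not> ([x, y, z, x] \<in> factors w \<and> [x, y, x] \<in> factors w \<and> [x, y, z, y, x] \<in> factors w)"
    if "distinct [x, y, z]" for x y z
    using avoids_upper2[OF assms(3), of "[x]" "[y]" "[z]"] unavoidable(1)[OF assms(1), of x z y]
      that by auto
  \<comment> \<open>If abca is present, then abcba is not, so acba is and acbca is not; clauses 6
    and 7 then force bacb and bacab. If abca is absent, then acbca is present and acba is not;
    clauses 3 and 4 force the same two words. With bab they contradict \<open>X\<close> for b, a,
    c.\<close>
  show ?thesis
    using X[of a b c] X[of a c b] X[of b a c] unavoidable(3-7)[OF assms(1,2)]
      unavoidable(5)[OF assms(1), of a c b] assms(2) by auto
qed

section \<open>Transport to \<open>b3\<close> by renaming letters\<close>

lemma equivalent_rename: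
  assumes "sqfree_language (factors w)" and "bij r"
    and "[r L0, r L1, r L0] \<notin> factors w" and "[r L2, r L1, r L2] \<notin> factors w"
  shows "equivalent w (r \<circ> b3)"
proof -
  have "thue_language {u. map r u \<in> factors w}"
    using sqfree_language_rename[OF assms(1,2)] assms(3,4)
    by (simp add: thue_language_def thue_language_axioms_def)
  then have "factors b3 = {u. map r u \<in> factors w}"
    using thue_language_eq_factors_b3 by blast
  moreover have "u \<in> map r ` {u. map r u \<in> factors w}" if "u \<in> factors w" for u
  proof
    show "u = map r (map (inv r) u)"
      using bij_is_surj[OF assms(2)] by (simp add: map_idI surj_f_inv_f)
    then show "map (inv r) u \<in> {u. map r u \<in> factors w}" using that by simp
  qed
  ultimately have "map r ` factors b3 = factors w" by auto
  then show ?thesis unfolding equivalent_def factors_comp by simp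
qed

lemma bij_sigma: "bij sigma"
proof (rule bijI)
  show "inj sigma"
  proof (rule injI)
    show "x = y" if "sigma x = sigma y" for x y using that by (cases x; cases y) simp_all
  qed
  have "sigma (sigma (sigma y)) = y" for y by (cases y) simp_all
  then show "surj sigma" by (rule surjI)
qed

theorem theorem10:
  fixes f :: "'v list set" and w :: "letter word"
  assumes "is_formula f"
    and "({''ABCA'', ''ABA'', ''ACA''} \<preceq> f \<and>
            f \<preceq> {''ABCA'', ''ABA'', ''ACA'', ''ACB'', ''CBA''}) \<or>
         ({''ABCA'', ''ABA'', ''BCB'', ''AC''} \<preceq> f \<and>
            f \<preceq> {''ABCA'', ''ABA'', ''ABCBA'', ''ACB''}) \<or>
         ({''ABCA'', ''ABA'', ''BCB'', ''CBA''} \<preceq> f \<and>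
            f \<preceq> {''ABCA'', ''ABA'', ''ABCBA'', ''ACB''})"
    and "recurrent w"
    and "avoids w f"
  shows "equivalent w b3 \<or> equivalent w (sigma \<circ> b3) \<or> equivalent w (sigma \<circ> sigma \<circ> b3)"
proof -
  have upper: "avoids w {''ABCA'', ''ABA'', ''ACA'', ''ACB'', ''CBA''} \<or>
      avoids w {''ABCA'', ''ABA'', ''ABCBA'', ''ACB''}"
    using assms(2) avoids_divides[OF assms(4)] by blast
  have lang: "sqfree_language (factors w)"
    using factors_sqfree_language[OF assms(3) upper] .
  obtain y where y: "\<And>x. x \<noteq> y \<Longrightarrow> [x, y, x] \<notin> factors w"
    using missing_middle_letter[OF lang] upper1_excluded[OF lang] upper2_excluded[OF lang] upper
    by blast
  show ?thesis
  \<comment> \<open>The renaming is the power of \<open>sigma\<close> that sends \<open>L1\<close>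
    to \<open>y\<close>.\<close>
  proof (cases y)
    case L0
    then show ?thesis
      using equivalent_rename[OF lang, of "sigma \<circ> sigma"] bij_comp[OF bij_sigma bij_sigma] y by simp
  next
    case L1
    then show ?thesis using equivalent_rename[OF lang, of id] y by simp
  next
    case L2
    then show ?thesis using equivalent_rename[OF lang, of sigma] bij_sigma y by simp
  qed
qed

end
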